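(* Let $0<\beta<1/2$ and $\nu>0$ be constants, and consider pairs of reals $(x,y)$ satisfying $$(\ln y)^{\nu}<\ln x<y^{\beta},$$ and put $u=\ln x/\ln y$. Then there exist constants $y_0$ and $\overline{a}>a^{\star}$ such that $$\frac{\ln\psi(x,y)}{\ln x}<1-\frac{\ln^{(2)}x+\ln^{(3)}x+\ln^{(4)}x}{\ln y}+\frac{\overline{a}+\ln^{(2)}y+\ln^{(3)}y}{\ln y}+\frac{\ln u}{u}$$ holds for all such pairs with $y>y_0$. If moreover $\nu>2$, then there is $y_1$ such that $$\frac{\ln\psi(x,y)}{\ln x}<1-\frac{\ln^{(2)}x+\ln^{(3)}x+\ln^{(4)}x}{\ln y}+\frac{\overline{a}+\ln^{(2)}y+\ln^{(3)}y}{\ln y}$$ holds for all such pairs with $y>y_1$. Moreover, $\overline{a}>a^{\star}$ may be taken arbitrarily close to $a^{\star}$ provided $\beta$ is small enough and $\nu$ is large enough.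
   Context: For positive reals $x,y$, $\psi(x,y)$ denotes the number of integers $2\le k\le x$ whose largest prime divisor does not exceed $y$. The iterated logarithm is $\ln^{(1)}x=\ln x$, $\ln^{(k+1)}x=\ln(\ln^{(k)}x)$. The constant $a^{\star}$ is $a^{\star}=1+\ln(e-1)$.
   Formalization: The first part is proved for ν > 1 instead of ν > 0: for every 0 < ν ≤ 1 the claim fails, since the pairs x = 2y satisfy the range condition for large y but violate the inequality for any ā, because of the term ln^(4) x. *)

theory Defs
  imports Complex_Main "HOL-Computational_Algebra.Primes"
begin

definition smooth_count :: "real \<Rightarrow> real \<Rightarrow> nat" where
  "smooth_count x y =
     card {k :: nat. 2 \<le> k \<and> real k \<le> x \<and> real (Max (prime_factors k)) \<le> y}"

definition iter_ln :: "nat \<Rightarrow> real \<Rightarrow> real" where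
  "iter_ln k x = (ln ^^ k) x"

definition a_star :: real where
  "a_star = 1 + ln (exp 1 - 1)"

text \<open>
  Only \<open>\<nu> > 1\<close> is meaningful in the bounds below. If \<open>0 < \<nu> \<le> 1\<close>, the range
  contains the pairs \<open>(2 * y, y)\<close> for all large \<open>y\<close>, and there the first bound fails
  whatever \<open>a\<close> is: its left-hand side is at least \<open>1 - O(1 / ln y)\<close>, its right-hand
  side at most \<open>1 - (iter_ln 4 y - O(1)) / ln y\<close>.
\<close>
definition admissible :: "real \<Rightarrow> real \<Rightarrow> real \<Rightarrow> real \<Rightarrow> bool" where
  "admissible \<beta> \<nu> x y \<longleftrightarrow>
     0 < x \<and> 0 < y \<and> ln y powr \<nu> < ln x \<and> ln x < y powr \<beta>"

definition main_bound :: "real \<Rightarrow> real \<Rightarrow> real \<Rightarrow> real" where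
  "main_bound a x y =
     1 - (iter_ln 2 x + iter_ln 3 x + iter_ln 4 x) / ln y
       + (a + iter_ln 2 y + iter_ln 3 y) / ln y"

definition bounds_hold :: "real \<Rightarrow> real \<Rightarrow> real \<Rightarrow> bool" where
  "bounds_hold \<beta> \<nu> a \<longleftrightarrow>
     (\<exists>y0. \<forall>x y. admissible \<beta> \<nu> x y \<and> y > y0 \<longrightarrow>
        (let u = ln x / ln y in
          ln (real (smooth_count x y)) / ln x < main_bound a x y + ln u / u)) \<and>
     (\<nu> > 2 \<longrightarrow>
       (\<exists>y1. \<forall>x y. admissible \<beta> \<nu> x y \<and> y > y1 \<longrightarrow>
          ln (real (smooth_count x y)) / ln x < main_bound a x y))"

end

theory Submission
  imports Defs "HOL-Analysis.Summation_Tests" "HOL-Real_Asymp.Real_Asymp"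
begin

text \<open>
  Rankin's method bounds the count by \<open>x powr \<alpha>\<close> times the Euler product over the primes up to
  \<open>y\<close>. With \<open>y powr (1 - \<alpha>) = u * ln u\<close> one has \<open>\<alpha> \<ge> 1 - \<beta> > 1 / 2\<close>, so prime squares contribute
  \<open>O(1)\<close>, and the Chebyshev bound \<open>\<theta>(n) \<le> n ln 4\<close> with partial summation makes the sum of
  \<open>p powr -\<alpha>\<close> at most about \<open>u ln 4\<close>. This replaces \<open>ln u + ln (ln u) - 1\<close>, the expected saving,
  by \<open>ln u + ln (ln u) - 3 / 2\<close>, which is affordable since \<open>a_star > 3 / 2\<close>. The contribution of the
  small primes is \<open>o(u)\<close> for every \<open>\<nu> > 1\<close>, so the bound without \<open>ln u / u\<close> holds throughout and
  implies the other one.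
\<close>

section \<open>A Chebyshev bound\<close>

text \<open>Row \<open>2 * m + 1\<close> of Pascal's triangle has sum \<open>2 * 4 ^ m\<close>, and
  its two middle entries are equal.\<close>

lemma central_odd_binomial_le: "(2 * m + 1) choose m \<le> 4 ^ m"
proof -
  have "(2 * m + 1 choose m) + (2 * m + 1 choose (m + 1)) = (\<Sum>k\<in>{m, m + 1}. 2 * m + 1 choose k)"
    by simp
  also have "\<dots> \<le> (\<Sum>k\<le>2 * m + 1. 2 * m + 1 choose k)"
    by (rule sum_mono2) auto
  also have "\<dots> = 2 * 4 ^ m"
    by (simp only: choose_row_sum) (simp add: power_mult)
  finally have *: "(2 * m + 1 choose m) + (2 * m + 1 choose (m + 1)) \<le> 2 * 4 ^ m" .
  have "(2 * m + 1 choose (m + 1)) = (2 * m + 1 choose m)"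
    by (subst binomial_symmetric) auto
  with * show ?thesis
    by linarith
qed

lemma prod_primes_dvd:
  fixes n :: nat
  assumes "finite P" "\<And>p. p \<in> P \<Longrightarrow> prime p \<and> p dvd n"
  shows "\<Prod>P dvd n"
  using assms
proof (induction P rule: finite_induct)
  case (insert q P)
  have "coprime q (\<Prod>P)"
    by (rule prod_coprime_right) (use insert in \<open>metis insertCI primes_coprime\<close>)
  with insert show ?case
    by (simp add: divides_mult)
qed auto

text \<open>Erdos's argument by strong induction. An even \<open>n > 2\<close> is not prime, so it
  reduces to \<open>n - 1\<close>. For \<open>n = 2 * m + 1\<close> the primes up to
  \<open>m + 1\<close> are covered by induction, and the remaining ones all divide
  \<open>n choose m\<close>, which is at most \<open>4 ^ m\<close>.\<close>

lemma primorial_le: "\<Prod>{p. prime p \<and> p \<le> n} \<le> (4 :: nat) ^ n"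
proof (induction n rule: less_induct)
  case (less n)
  consider "n \<le> 2" | "n > 2" "even n" | "n > 2" "odd n"
    by linarith
  then show ?case
  proof cases
    case 1
    have "{p :: nat. prime p \<and> p \<le> n} = (if n = 2 then {2} else {})"
      using 1 by (auto dest: prime_ge_2_nat)
    then show ?thesis
      by auto
  next
    case 2
    then have "\<not> prime n"
      using prime_odd_nat by blast
    then have "{p. prime p \<and> p \<le> n} = {p. prime p \<and> p \<le> n - 1}"
      by (metis le_eq_less_or_eq less_Suc_eq_le Suc_pred' diff_le_self le_trans not_prime_0 gr0I)
    moreover have "\<Prod>{p. prime p \<and> p \<le> n - 1} \<le> (4 :: nat) ^ (n - 1)"
      using 2 by (intro less) auto
    moreover have "(4 :: nat) ^ (n - 1) \<le> 4 ^ n"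
      by (rule power_increasing) auto
    ultimately show ?thesis
      by (metis le_trans)
  next
    case 3
    then obtain m where m: "n = 2 * m + 1"
      by (auto elim: oddE)
    let ?Q = "{p. prime p \<and> m + 1 < p \<and> p \<le> n}"
    \<comment> \<open>Such a prime divides \<open>fact n\<close> but neither \<open>fact m\<close>
      nor \<open>fact (n - m)\<close>, because \<open>n - m = m + 1 < p\<close>.\<close>
    have "p dvd (n choose m)" if "p \<in> ?Q" for p
    proof -
      have "p dvd fact m * fact (n - m) * (n choose m)"
        using that by (subst binomial_fact_lemma) (simp_all add: m prime_dvd_fact_iff del: fact_Suc)
      then show ?thesis
        using that by (auto simp: m prime_dvd_mult_iff prime_dvd_fact_iff simp del: fact_Suc)
    qed
    then have "\<Prod>?Q dvd (n choose m)"
      by (intro prod_primes_dvd) auto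
    then have "\<Prod>?Q \<le> (n choose m)"
      by (rule dvd_imp_le) (simp add: m)
    then have Q: "\<Prod>?Q \<le> 4 ^ m"
      using central_odd_binomial_le[of m] by (simp add: m)
    have P: "\<Prod>{p. prime p \<and> p \<le> m + 1} \<le> (4 :: nat) ^ (m + 1)"
      using 3 by (intro less) (auto simp: m)
    have "{p. prime p \<and> p \<le> n} = {p. prime p \<and> p \<le> m + 1} \<union> ?Q"
      using m by auto
    then have "\<Prod>{p. prime p \<and> p \<le> n} = \<Prod>{p. prime p \<and> p \<le> m + 1} * \<Prod>?Q"
      by (simp only:) (rule prod.union_disjoint, auto)
    also have "\<dots> \<le> 4 ^ (m + 1) * 4 ^ m"
      by (intro mult_mono P Q) auto
    also have "\<dots> = 4 ^ n"
      by (simp add: m power_add mult_2)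
    finally show ?thesis .
  qed
qed

lemma sum_ln_primes_le: "(\<Sum>p | prime p \<and> p \<le> n. ln (real p)) \<le> ln 4 * real n"
proof -
  have "(\<Sum>p | prime p \<and> p \<le> n. ln (real p)) = ln (\<Prod>p | prime p \<and> p \<le> n. real p)"
    by (subst ln_prod) (auto simp: prime_gt_0_nat)
  also have "\<dots> = ln (real (\<Prod>{p. prime p \<and> p \<le> n}))"
    by simp
  also have "\<dots> \<le> ln (real (4 ^ n))"
    by (subst ln_le_cancel_iff) (auto simp del: of_nat_prod of_nat_power simp: primorial_le
        intro!: prod_pos prime_gt_0_nat)
  also have "\<dots> = ln 4 * real n"
    by (simp add: ln_realpow)
  finally show ?thesis .
qed

section \<open>Sums over primes\<close>

text \<open>Summation by parts as an induction. The claim is strengthened by the boundary term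
  \<open>(C * real N - sum b {1..N}) * f N\<close>: it is nonnegative, and replacing
  \<open>f N\<close> by the smaller \<open>f (Suc N)\<close> only lowers it.\<close>

lemma sum_mult_decreasing_le:
  fixes b f :: "nat \<Rightarrow> real"
  assumes b: "\<And>m. sum b {1..m} \<le> C * real m"
    and f: "decseq f" "\<And>n. f n \<ge> 0"
  shows "(\<Sum>n=1..N. b n * f n) \<le> C * (\<Sum>n=1..N. f n)"
proof -
  have "(\<Sum>n=1..N. b n * f n) + (C * real N - sum b {1..N}) * f N \<le> C * (\<Sum>n=1..N. f n)"
  proof (induction N)
    case (Suc N)
    have "(C * real N - sum b {1..N}) * f (Suc N) \<le> (C * real N - sum b {1..N}) * f N"
      using b[of N] f(1) by (intro mult_left_mono) (auto simp: decseq_def)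
    with Suc show ?case
      by (simp add: algebra_simps)
  qed auto
  moreover have "(C * real N - sum b {1..N}) * f N \<ge> 0"
    using b[of N] f(2)[of N] by simp
  ultimately show ?thesis
    by linarith
qed

lemma half_le_ln_2: "1 / 2 \<le> ln (2 :: real)"
  using ln_le_minus_one[of "1 / 2 :: real"] by (simp add: ln_div)

text \<open>Sharp enough to keep the final constant \<open>ln 4 * (20 / 19) + 1 / 50\<close> below
  \<open>3 / 2\<close>. The quadratic Taylor bound is too weak at \<open>7 / 10\<close> itself,
  hence the fourth power of its value at \<open>7 / 40\<close>.\<close>

lemma ln_2_le: "ln 2 \<le> (7 / 10 :: real)"
proof -
  have "1 + 7 / 40 + (7 / 40)\<^sup>2 / 2 \<le> exp (7 / 40 :: real)"
    by (rule exp_lower_Taylor_quadratic) auto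
  then have "119 / 100 \<le> exp (7 / 40 :: real)"
    by (simp add: power_divide)
  then have "(119 / 100) ^ 4 \<le> exp (7 / 40 :: real) ^ 4"
    by (intro power_mono) auto
  also have "\<dots> = exp (7 / 10)"
    using exp_of_nat_mult[of 4 "7 / 40 :: real"] by simp
  finally have "2 \<le> exp (7 / 10 :: real)"
    by (simp add: power_divide)
  then show ?thesis
    using ln_mono[of 2 "exp (7 / 10) :: real"] by simp
qed

text \<open>Each term is \<open>ln p\<close> times \<open>p powr -\<alpha> / ln p\<close>, so the
  bound on the sum of \<open>ln p\<close> can be fed into summation by parts. The summand 2 on the
  right pays for the index 1.\<close>

lemma sum_primes_powr_le:
  fixes \<alpha> :: real
  assumes "\<alpha> \<ge> 0"
  shows "(\<Sum>p | prime p \<and> p \<le> N. real p powr -\<alpha>)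
    \<le> ln 4 * (2 + (\<Sum>n=2..N. real n powr -\<alpha> / ln (real n)))"
proof (cases "N \<ge> 2")
  case False
  then have "{p. prime p \<and> p \<le> N} = {}"
    by (auto dest: prime_ge_2_nat)
  then show ?thesis
    unfolding \<open>{p. prime p \<and> p \<le> N} = {}\<close> using False by simp
next
  case True
  define b :: "nat \<Rightarrow> real" where "b = (\<lambda>n. if prime n then ln (real n) else 0)"
  \<comment> \<open>Freezing the argument at 2 avoids division by \<open>ln 1 = 0\<close> and keeps
    \<open>f\<close> decreasing on all of \<open>nat\<close>; in particular
    \<open>f 1 = f 2\<close>.\<close>
  define f :: "nat \<Rightarrow> real"
    where "f = (\<lambda>n. real (max 2 n) powr -\<alpha> / ln (real (max 2 n)))"
  have f1: "f 1 \<le> 2"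
  proof -
    have "(2 :: real) powr -\<alpha> \<le> 2 powr 0"
      using assms by (intro powr_mono) auto
    then have "2 powr -\<alpha> / ln 2 \<le> 1 / (1 / 2 :: real)"
      using half_le_ln_2 by (intro frac_le) auto
    then show ?thesis
      by (simp add: f_def)
  qed
  have primes: "{1..N} \<inter> {p. prime p} = {p. prime p \<and> p \<le> N}" for N :: nat
    by (auto simp: Suc_le_eq prime_gt_0_nat)
  have "(\<Sum>p | prime p \<and> p \<le> N. real p powr -\<alpha>) = (\<Sum>p | prime p \<and> p \<le> N. ln (real p) * f p)"
  proof (rule sum.cong)
    fix p assume "p \<in> {p. prime p \<and> p \<le> N}"
    then have "p \<ge> 2"
      using prime_ge_2_nat by auto
    then show "real p powr -\<alpha> = ln (real p) * f p"
      by (simp add: f_def max_def)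
  qed auto
  also have "\<dots> = (\<Sum>n=1..N. b n * f n)"
    by (subst primes[symmetric], subst sum.inter_restrict) (auto simp: b_def intro!: sum.cong)
  also have "\<dots> \<le> ln 4 * (\<Sum>n=1..N. f n)"
  proof (rule sum_mult_decreasing_le)
    fix m
    have "sum b {1..m} = (\<Sum>p | prime p \<and> p \<le> m. ln (real p))"
      by (subst primes[symmetric], subst sum.inter_restrict) (auto simp: b_def)
    then show "sum b {1..m} \<le> ln 4 * real m"
      using sum_ln_primes_le by simp
  next
    show "decseq f"
      unfolding f_def decseq_def using assms
      by (intro allI impI frac_le powr_mono2') (auto simp: max_def)
    show "f n \<ge> 0" for n
      by (auto simp: f_def)
  qed
  also have "(\<Sum>n=1..N. f n) = f 1 + (\<Sum>n=2..N. f n)"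
    using True by (subst sum.atLeast_Suc_atMost) (auto simp: numeral_2_eq_2)
  also have "(\<Sum>n=2..N. f n) = (\<Sum>n=2..N. real n powr -\<alpha> / ln (real n))"
    by (intro sum.cong) (auto simp: f_def max_def)
  also have "ln 4 * (f 1 + (\<Sum>n=2..N. real n powr -\<alpha> / ln (real n)))
      \<le> ln 4 * (2 + (\<Sum>n=2..N. real n powr -\<alpha> / ln (real n)))"
    using f1 by (intro mult_left_mono add_right_mono) auto
  finally show ?thesis .
qed

text \<open>Comparison with the integral of \<open>t powr -\<alpha>\<close>, done term by term: the
  mean value theorem bounds each summand by an increment of the antiderivative.\<close>

lemma sum_powr_le:
  fixes \<alpha> :: real
  assumes "0 \<le> \<alpha>" "\<alpha> < 1"
  shows "(\<Sum>n=2..N. real n powr -\<alpha>) \<le> real N powr (1 - \<alpha>) / (1 - \<alpha>)"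
proof (induction N)
  case (Suc N)
  show ?case
  proof (cases "N = 0")
    case False
    have "((\<lambda>t. t powr (1 - \<alpha>)) has_real_derivative (1 - \<alpha>) * t powr (1 - \<alpha> - 1)) (at t)"
      if "real N \<le> t" for t
      using that False by (intro has_real_derivative_powr) auto
    then obtain z where z: "real N < z" "z < real (Suc N)"
      "real (Suc N) powr (1 - \<alpha>) - real N powr (1 - \<alpha>)
        = (real (Suc N) - real N) * ((1 - \<alpha>) * z powr (1 - \<alpha> - 1))"
      using MVT2[of "real N" "real (Suc N)" "\<lambda>t. t powr (1 - \<alpha>)"
          "\<lambda>t. (1 - \<alpha>) * t powr (1 - \<alpha> - 1)"]
      by (auto simp del: of_nat_Suc)
    have "real (Suc N) powr -\<alpha> \<le> z powr -\<alpha>"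
      using z False assms by (intro powr_mono2') auto
    then have "(1 - \<alpha>) * real (Suc N) powr -\<alpha> \<le> (1 - \<alpha>) * z powr -\<alpha>"
      using assms by (intro mult_left_mono) auto
    then have "real (Suc N) powr -\<alpha>
      \<le> (real (Suc N) powr (1 - \<alpha>) - real N powr (1 - \<alpha>)) / (1 - \<alpha>)"
      using z assms by (simp add: field_simps)
    then show ?thesis
      using Suc False by (simp add: diff_divide_distrib)
  qed (use assms in auto)
qed (use assms in auto)

text \<open>Comparison with the antiderivative \<open>ln (ln t)\<close>. The constant 2 covers the
  term at 2, which is at most 1, and \<open>- ln (ln 2)\<close>, which is at most
  \<open>ln 2 \<le> 1\<close>.\<close>

lemma sum_inverse_n_ln_le:
  assumes "N \<ge> 2"
  shows "(\<Sum>n=2..N. 1 / (real n * ln (real n))) \<le> ln (ln (real N)) + 2"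
  using assms
proof (induction N rule: dec_induct)
  case base
  have "1 / (2 * ln 2) \<le> (1 :: real)"
    using half_le_ln_2 by (simp add: field_simps)
  moreover have "- ln 2 \<le> ln (ln (2 :: real))"
    using ln_mono[OF half_le_ln_2] by (simp add: ln_div)
  moreover have "ln (2 :: real) \<le> 1"
    using ln_le_minus_one[of "2 :: real"] by simp
  moreover have "(\<Sum>n=2..2. 1 / (real n * ln (real n))) = 1 / (2 * ln 2)"
    by simp
  ultimately show ?case
    by (simp only: of_nat_numeral)
next
  case (step n)
  have "((\<lambda>t. ln (ln t)) has_real_derivative 1 / (t * ln t)) (at t)" if "real n \<le> t" for t
    using that step.hyps by (auto intro!: derivative_eq_intros simp: field_simps)
  then obtain z where z: "real n < z" "z < real (Suc n)"
    "ln (ln (real (Suc n))) - ln (ln (real n)) = (real (Suc n) - real n) * (1 / (z * ln z))"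
    using MVT2[of "real n" "real (Suc n)" "\<lambda>t. ln (ln t)" "\<lambda>t. 1 / (t * ln t)"]
    by (auto simp del: of_nat_Suc)
  have "1 / (real (Suc n) * ln (real (Suc n))) \<le> 1 / (z * ln z)"
    using z step by (intro frac_le mult_mono mult_pos_pos) auto
  then show ?case
    using step z by simp
qed

text \<open>
  The range splits at \<open>y powr (19 / 20)\<close>: above it \<open>ln n\<close> is nearly \<open>ln y\<close>, below it
  \<open>n powr (1 - \<alpha>)\<close> is much smaller than \<open>y powr (1 - \<alpha>)\<close>.
\<close>
lemma sum_powr_div_ln_le:
  fixes \<alpha> y :: real
  assumes "0 \<le> \<alpha>" "\<alpha> < 1" "y \<ge> 2"
  shows "(\<Sum>n=2..nat \<lfloor>y\<rfloor>. real n powr -\<alpha> / ln (real n))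
    \<le> 20 / 19 * y powr (1 - \<alpha>) / ((1 - \<alpha>) * ln y)
      + (y powr (1 - \<alpha>)) powr (19 / 20) * (ln (ln y) + 2)"
proof -
  define N where "N = nat \<lfloor>y\<rfloor>"
  define w where "w = (y powr (1 - \<alpha>)) powr (19 / 20)"
  have N: "N \<ge> 2" "real N \<le> y"
    using assms unfolding N_def by linarith+
  \<comment> \<open>The sum itself is not split: each term is bounded by the sum of two nonnegative
    quantities, one of which suffices in each range.\<close>
  have "real n powr -\<alpha> / ln (real n)
      \<le> 20 / 19 / ln y * real n powr -\<alpha> + w * (1 / (real n * ln (real n)))"
    if "n \<in> {2..N}" for n
  proof (cases "real n \<le> y powr (19 / 20)")
    case True
    have "real n powr (1 - \<alpha>) \<le> (y powr (19 / 20)) powr (1 - \<alpha>)"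
      using True assms by (intro powr_mono2) auto
    also have "\<dots> = w"
      by (simp add: w_def powr_powr mult.commute)
    finally have "real n powr (1 - \<alpha>) / (real n * ln (real n)) \<le> w / (real n * ln (real n))"
      using that by (intro divide_right_mono) auto
    moreover have "real n powr (1 - \<alpha>) / (real n * ln (real n)) = real n powr -\<alpha> / ln (real n)"
      using that by (simp add: powr_diff powr_minus field_simps)
    moreover have "20 / 19 / ln y * real n powr -\<alpha> \<ge> 0"
      using assms by simp
    ultimately show ?thesis
      by simp
  next
    case False
    have "19 / 20 * ln y = ln (y powr (19 / 20))"
      using assms by (simp add: ln_powr)
    also have "\<dots> \<le> ln (real n)"
      using False assms by (intro ln_mono) auto
    finally have "19 / 20 * ln y \<le> ln (real n)" .
    moreover have "n > 0"
      using that by simp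
    ultimately have "real n powr -\<alpha> / ln (real n) \<le> real n powr -\<alpha> / (19 / 20 * ln y)"
      using assms that by (intro divide_left_mono) (auto intro!: mult_pos_pos)
    moreover have "w * (1 / (real n * ln (real n))) \<ge> 0"
      using that by (auto simp: w_def)
    ultimately show ?thesis
      by simp
  qed
  then have "(\<Sum>n=2..N. real n powr -\<alpha> / ln (real n))
      \<le> 20 / 19 / ln y * (\<Sum>n=2..N. real n powr -\<alpha>)
        + w * (\<Sum>n=2..N. 1 / (real n * ln (real n)))"
    unfolding sum_distrib_left sum.distrib[symmetric] by (rule sum_mono)
  also have "\<dots> \<le> 20 / 19 / ln y * (y powr (1 - \<alpha>) / (1 - \<alpha>)) + w * (ln (ln y) + 2)"
  proof (intro add_mono mult_left_mono)
    have "real N powr (1 - \<alpha>) / (1 - \<alpha>) \<le> y powr (1 - \<alpha>) / (1 - \<alpha>)"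
      using N assms by (intro divide_right_mono powr_mono2) auto
    then show "(\<Sum>n=2..N. real n powr -\<alpha>) \<le> y powr (1 - \<alpha>) / (1 - \<alpha>)"
      using sum_powr_le[of \<alpha> N] assms by linarith
    have "ln (ln (real N)) \<le> ln (ln y)"
      using N by (subst ln_le_cancel_iff) auto
    then show "(\<Sum>n=2..N. 1 / (real n * ln (real n))) \<le> ln (ln y) + 2"
      using sum_inverse_n_ln_le[OF N(1)] by linarith
  qed (use assms in \<open>auto simp: w_def\<close>)
  finally show ?thesis
    by (simp add: N_def w_def mult_ac)
qed

section \<open>Rankin's method\<close>

text \<open>Induction on the set of primes. Removing the exact power of the new prime
  \<open>q\<close> sends \<open>A\<close> injectively into pairs of an exponent and a
  \<open>q\<close>-free part; the exponents contribute a partial geometric series, the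
  \<open>q\<close>-free parts fall under the induction hypothesis. With \<open>A\<close> finite, no
  infinite series over integers is involved.\<close>

lemma sum_powr_le_Euler_product:
  fixes \<alpha> :: real
  assumes "finite P" "\<And>p. p \<in> P \<Longrightarrow> prime p" "\<alpha> > 0"
    and "finite A" "\<And>k. k \<in> A \<Longrightarrow> k > 0 \<and> prime_factors k \<subseteq> P"
  shows "(\<Sum>k\<in>A. real k powr -\<alpha>) \<le> (\<Prod>p\<in>P. 1 / (1 - real p powr -\<alpha>))"
  using assms(1,2,4,5)
proof (induction P arbitrary: A rule: finite_induct)
  case empty
  have "A \<subseteq> {1}"
    using empty by (auto simp: prime_factorization_empty_iff)
  then have "(\<Sum>k\<in>A. real k powr -\<alpha>) \<le> (\<Sum>k\<in>{1 :: nat}. real k powr -\<alpha>)"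
    by (intro sum_mono2) auto
  then show ?case
    by simp
next
  case (insert q P)
  have q: "prime q"
    using insert by auto
  define g :: "nat \<Rightarrow> real" where "g = (\<lambda>k. real k powr -\<alpha>)"
  define B where "B = (\<lambda>k. k div q ^ multiplicity q k) ` A"
  \<comment> \<open>\<open>N\<close> exceeds every exponent that occurs; inserting 0 keeps
    \<open>Max\<close> meaningful for empty \<open>A\<close>.\<close>
  define N where "N = Suc (Max (insert 0 (multiplicity q ` A)))"
  define h where "h = (\<lambda>k. (multiplicity q k, k div q ^ multiplicity q k))"
  have decomp: "q ^ multiplicity q k * (k div q ^ multiplicity q k) = k" for k
    using multiplicity_dvd[of q k] by simp
  have g_mult: "g (a * b) = g a * g b" for a b
    by (simp add: g_def powr_mult)
  have g_pow: "g (a ^ i) = g a ^ i" for a i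
    by (induction i) (simp_all add: g_mult, simp add: g_def)
  have gq: "0 \<le> g q" "g q < 1"
    using q assms(3) prime_gt_1_nat[OF q] by (auto simp: g_def powr_less_one)
  have "(\<Sum>k\<in>A. g k) = (\<Sum>k\<in>A. case h k of (i, m) \<Rightarrow> g q ^ i * g m)"
    by (intro sum.cong) (simp_all add: h_def flip: g_mult g_pow, simp add: decomp)
  also have "\<dots> = (\<Sum>(i, m)\<in>h ` A. g q ^ i * g m)"
  proof (subst sum.reindex)
    show "inj_on h A"
      by (intro inj_onI) (metis h_def decomp prod.inject)
  qed simp
  also have "\<dots> \<le> (\<Sum>(i, m)\<in>{..<N} \<times> B. g q ^ i * g m)"
  proof (rule sum_mono2)
    show "h ` A \<subseteq> {..<N} \<times> B"
      using insert.prems by (auto simp: h_def B_def N_def less_Suc_eq_le)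
  qed (use insert.prems gq in \<open>auto simp: B_def g_def\<close>)
  also have "\<dots> = (\<Sum>i<N. g q ^ i) * (\<Sum>m\<in>B. g m)"
    by (simp add: sum_product sum.cartesian_product)
  also have "\<dots> \<le> 1 / (1 - g q) * (\<Prod>p\<in>P. 1 / (1 - g p))"
  proof (rule mult_mono)
    show "(\<Sum>i<N. g q ^ i) \<le> 1 / (1 - g q)"
      using gq by (simp add: sum_gp_strict divide_right_mono)
    show "(\<Sum>m\<in>B. g m) \<le> (\<Prod>p\<in>P. 1 / (1 - g p))"
      unfolding g_def
    proof (rule insert.IH)
      fix m assume "m \<in> B"
      then obtain k where k: "k \<in> A" "m = k div q ^ multiplicity q k"
        by (auto simp: B_def)
      have k0: "k > 0" and kP: "prime_factors k \<subseteq> insert q P"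
        using insert.prems k by auto
      have "m > 0" "m dvd k"
        using decomp[of k] k0 k by (metis gr0I mult_0_right, metis dvd_triv_right)
      moreover have "\<not> q dvd m"
        using k k0 q multiplicity_decompose[of k q] by (metis not_gr0 not_prime_unit)
      ultimately show "m > 0 \<and> prime_factors m \<subseteq> P"
        using kP k0 dvd_prime_factors[of k m] by (auto simp: prime_factors_dvd)
    qed (use insert.prems in \<open>auto simp: B_def\<close>)
  qed (use gq in \<open>auto simp: g_def intro!: sum_nonneg\<close>)
  finally show ?case
    using insert.hyps by (simp add: g_def)
qed

text \<open>Rankin's trick: every counted \<open>k\<close> satisfies \<open>k \<le> x\<close>, so it
  can be weighted by \<open>(x / k) powr \<alpha> \<ge> 1\<close>.\<close>

lemma smooth_count_le_Euler_product:
  fixes \<alpha> x y :: real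
  assumes "\<alpha> > 0" "x > 0"
  shows "real (smooth_count x y)
    \<le> x powr \<alpha> * (\<Prod>p | prime p \<and> p \<le> nat \<lfloor>y\<rfloor>. 1 / (1 - real p powr -\<alpha>))"
proof -
  define A where "A = {k :: nat. 2 \<le> k \<and> real k \<le> x \<and> real (Max (prime_factors k)) \<le> y}"
  have "A \<subseteq> {..nat \<lfloor>x\<rfloor>}"
    by (auto simp: A_def le_nat_floor)
  then have fin: "finite A"
    using finite_subset by blast
  have "real (card A) = (\<Sum>k\<in>A. 1)"
    by simp
  also have "\<dots> \<le> (\<Sum>k\<in>A. x powr \<alpha> * real k powr -\<alpha>)"
  proof (rule sum_mono)
    fix k assume "k \<in> A"
    then have "1 \<le> x / real k"
      by (simp add: A_def)
    then have "1 \<le> (x / real k) powr \<alpha>"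
      using assms by (intro ge_one_powr_ge_zero) auto
    then show "1 \<le> x powr \<alpha> * real k powr -\<alpha>"
      using assms by (simp add: powr_divide powr_minus field_simps)
  qed
  also have "\<dots> = x powr \<alpha> * (\<Sum>k\<in>A. real k powr -\<alpha>)"
    by (simp add: sum_distrib_left)
  also have "\<dots> \<le> x powr \<alpha> * (\<Prod>p | prime p \<and> p \<le> nat \<lfloor>y\<rfloor>. 1 / (1 - real p powr -\<alpha>))"
  proof (intro mult_left_mono sum_powr_le_Euler_product fin assms)
    fix k assume k: "k \<in> A"
    have "p \<le> nat \<lfloor>y\<rfloor>" if "p \<in> prime_factors k" for p
    proof -
      have "p \<le> Max (prime_factors k)"
        using that by simp
      then show ?thesis
        using k by (intro le_nat_floor) (auto simp: A_def)
    qed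
    with k show "k > 0 \<and> prime_factors k \<subseteq> {p. prime p \<and> p \<le> nat \<lfloor>y\<rfloor>}"
      by (auto simp: A_def)
  qed auto
  finally show ?thesis
    by (simp add: smooth_count_def A_def)
qed

lemma neg_ln_one_minus_le:
  fixes t :: real
  assumes "0 \<le> t" "t \<le> 3 / 4"
  shows "- ln (1 - t) \<le> t + 4 * t\<^sup>2"
proof -
  have "- ln (1 - t) = ln (1 / (1 - t))"
    using assms by (simp add: ln_div)
  also have "\<dots> \<le> 1 / (1 - t) - 1"
    using assms by (intro ln_le_minus_one) auto
  also have "\<dots> = t + t\<^sup>2 / (1 - t)"
    using assms by (simp add: field_simps power2_eq_square)
  also have "t\<^sup>2 / (1 - t) \<le> t\<^sup>2 / (1 / 4)"
    using assms by (intro divide_left_mono) auto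
  finally show ?thesis
    by simp
qed

text \<open>The logarithm of the Euler product is the sum of \<open>p powr -\<alpha>\<close> up to a
  sum of squares. The fixed lower bound \<open>\<alpha>0 > 1 / 2\<close> makes that error a
  convergent series independent of \<open>\<alpha>\<close>, \<open>x\<close> and
  \<open>y\<close>.\<close>

lemma ln_smooth_count_le:
  fixes \<alpha> \<alpha>0 x y :: real
  assumes "1 / 2 < \<alpha>0" "\<alpha>0 \<le> \<alpha>" "x \<ge> 2" "y \<ge> 2"
  shows "ln (real (smooth_count x y)) \<le> \<alpha> * ln x
    + (\<Sum>p | prime p \<and> p \<le> nat \<lfloor>y\<rfloor>. real p powr -\<alpha>) + 4 * (\<Sum>n. real n powr - (2 * \<alpha>0))"
proof -
  let ?P = "{p. prime p \<and> p \<le> nat \<lfloor>y\<rfloor>}"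
  define t where "t = (\<lambda>p :: nat. real p powr -\<alpha>)"
  have t: "0 \<le> t p" "t p \<le> 3 / 4" "(t p)\<^sup>2 \<le> real p powr - (2 * \<alpha>0)" if "p \<in> ?P" for p
  proof -
    have p: "real p \<ge> 2"
      using that prime_ge_2_nat by fastforce
    show "0 \<le> t p"
      by (simp add: t_def)
    have "t p \<le> real p powr - (1 / 2)"
      using p assms by (auto simp: t_def intro!: powr_mono)
    also have "\<dots> \<le> 2 powr - (1 / 2)"
      using p by (intro powr_mono2') auto
    also have "\<dots> = 1 / sqrt 2"
      by (simp add: powr_minus powr_half_sqrt field_simps)
    also have "\<dots> \<le> 3 / 4"
    proof -
      have "4 / 3 \<le> sqrt 2"
        by (rule real_le_rsqrt) (simp add: power2_eq_square)
      then show ?thesis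
        by (simp add: field_simps)
    qed
    finally show "t p \<le> 3 / 4" .
    have "(t p)\<^sup>2 = real p powr - (2 * \<alpha>)"
      using p by (simp add: t_def power2_eq_square flip: powr_add)
    also have "\<dots> \<le> real p powr - (2 * \<alpha>0)"
      using p assms by (intro powr_mono) auto
    finally show "(t p)\<^sup>2 \<le> real p powr - (2 * \<alpha>0)" .
  qed
  have pos: "1 / (1 - t p) > 0" if "p \<in> ?P" for p
    using t(2)[OF that] by simp
  \<comment> \<open>Monotonicity of \<open>ln\<close> requires a positive count: the counted set is
    finite and contains 2.\<close>
  have "{k :: nat. 2 \<le> k \<and> real k \<le> x \<and> real (Max (prime_factors k)) \<le> y} \<subseteq> {..nat \<lfloor>x\<rfloor>}"
    by (auto simp: le_nat_floor)
  then have "finite {k :: nat. 2 \<le> k \<and> real k \<le> x \<and> real (Max (prime_factors k)) \<le> y}"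
    using finite_subset by blast
  moreover have "2 \<in> {k :: nat. 2 \<le> k \<and> real k \<le> x \<and> real (Max (prime_factors k)) \<le> y}"
    using assms by (simp add: prime_factorization_prime[of "2 :: nat"])
  ultimately have "smooth_count x y > 0"
    unfolding smooth_count_def card_gt_0_iff by blast
  then have "ln (real (smooth_count x y)) \<le> ln (x powr \<alpha> * (\<Prod>p\<in>?P. 1 / (1 - t p)))"
    using smooth_count_le_Euler_product[of \<alpha> x y] assms by (intro ln_mono) (auto simp: t_def)
  also have "\<dots> = \<alpha> * ln x + (\<Sum>p\<in>?P. ln (1 / (1 - t p)))"
  proof -
    have "(\<Prod>p\<in>?P. 1 / (1 - t p)) > 0"
      using pos by (rule prod_pos)
    moreover have "ln (\<Prod>p\<in>?P. 1 / (1 - t p)) = (\<Sum>p\<in>?P. ln (1 / (1 - t p)))"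
    proof (rule ln_prod)
      show "1 / (1 - t p) \<noteq> 0" if "p \<in> ?P" for p
        using pos[OF that] by (rule less_imp_neq[symmetric])
    qed simp
    ultimately show ?thesis
      using assms by (simp add: ln_mult_pos ln_powr)
  qed
  also have "(\<Sum>p\<in>?P. ln (1 / (1 - t p))) \<le> (\<Sum>p\<in>?P. t p + 4 * (t p)\<^sup>2)"
  proof (rule sum_mono)
    fix p assume p: "p \<in> ?P"
    then show "ln (1 / (1 - t p)) \<le> t p + 4 * (t p)\<^sup>2"
      using neg_ln_one_minus_le[of "t p"] t[OF p] by (simp add: ln_div)
  qed
  also have "\<dots> = (\<Sum>p\<in>?P. t p) + 4 * (\<Sum>p\<in>?P. (t p)\<^sup>2)"
    by (simp add: sum.distrib sum_distrib_left)
  also have "(\<Sum>p\<in>?P. (t p)\<^sup>2) \<le> (\<Sum>p\<in>?P. real p powr - (2 * \<alpha>0))"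
    by (intro sum_mono t)
  also have "\<dots> \<le> (\<Sum>n. real n powr - (2 * \<alpha>0))"
    using assms by (intro sum_le_suminf) (auto simp: summable_real_powr_iff)
  finally show ?thesis
    by (simp add: t_def)
qed

text \<open>
  The exponent \<open>\<alpha>\<close> is chosen with \<open>y powr (1 - \<alpha>) = u * ln u\<close>, approximately the minimiser.
\<close>
lemma ln_smooth_count_le_explicit:
  fixes \<beta> x y u :: real
  assumes "\<beta> < 1 / 2" "y \<ge> 3" "u = ln x / ln y" "u \<ge> 3" "x > 0" "ln x < y powr \<beta>"
  shows "ln (real (smooth_count x y)) \<le> ln x - u * (ln u + ln (ln u)) + ln 4 * (20 / 19) * u
    + (ln 4 * (2 + (u * ln u) powr (19 / 20) * (ln (ln y) + 2))
       + 4 * (\<Sum>n. real n powr - (2 * (1 - \<beta>))))"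
proof -
  define s where "s = ln u + ln (ln u)"
  define \<alpha> where "\<alpha> = 1 - s / ln y"
  have "exp 1 \<le> (3 :: real)"
    by (rule exp_le)
  then have lny: "ln y \<ge> 1" and lnu: "ln u \<ge> 1"
    using assms by (auto simp: ln_ge_iff intro: order_trans)
  have lnx: "ln x = u * ln y"
    using assms lny by simp
  have s: "s \<ge> ln u"
    using lnu by (simp add: s_def)
  have "u * 1 \<le> u * ln y"
    using lny assms by (intro mult_left_mono) auto
  then have u_le: "u \<le> ln x"
    by (simp add: lnx)
  have "y powr \<beta> \<le> y powr 1"
    using assms by (intro powr_mono) auto
  then have "u \<le> y"
    using u_le assms by simp
  then have "ln u \<le> ln y"
    using assms by (subst ln_le_cancel_iff) auto
  \<comment> \<open>This is where the upper limit on \<open>ln x\<close> enters: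
    \<open>u * ln u \<le> ln x < y powr \<beta>\<close> gives \<open>s \<le> \<beta> * ln y\<close>,
    that is, \<open>\<alpha> \<ge> 1 - \<beta> > 1 / 2\<close>.\<close>
  then have "u * ln u \<le> ln x"
    unfolding lnx using assms by (intro mult_left_mono) auto
  then have "u * ln u \<le> y powr \<beta>"
    using assms by linarith
  moreover have "u * ln u > 0"
    using \<open>u \<ge> 3\<close> lnu by simp
  ultimately have "ln (u * ln u) \<le> ln (y powr \<beta>)"
    by (intro ln_mono)
  moreover have "ln (u * ln u) = s"
    unfolding s_def using \<open>u \<ge> 3\<close> lnu by (intro ln_mult_pos) auto
  ultimately have "s \<le> \<beta> * ln y"
    using assms by (simp add: ln_powr)
  then have \<alpha>: "1 - \<beta> \<le> \<alpha>" "\<alpha> < 1"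
    using lny lnu s by (auto simp: \<alpha>_def field_simps)
  have ypow: "y powr (1 - \<alpha>) = u * ln u"
  proof -
    have "y powr (1 - \<alpha>) = exp s"
      using lny \<open>y \<ge> 3\<close> by (simp add: \<alpha>_def powr_def)
    also have "\<dots> = u * ln u"
      using \<open>u \<ge> 3\<close> lnu by (simp add: s_def exp_add)
    finally show ?thesis .
  qed
  have "x \<ge> 2"
    using ln_le_minus_one[OF \<open>x > 0\<close>] u_le assms by linarith
  then have "ln (real (smooth_count x y)) \<le> \<alpha> * ln x
      + (\<Sum>p | prime p \<and> p \<le> nat \<lfloor>y\<rfloor>. real p powr -\<alpha>)
      + 4 * (\<Sum>n. real n powr - (2 * (1 - \<beta>)))"
    using assms \<alpha> by (intro ln_smooth_count_le) auto
  also have "(\<Sum>p | prime p \<and> p \<le> nat \<lfloor>y\<rfloor>. real p powr -\<alpha>)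
      \<le> ln 4 * (2 + (\<Sum>n=2..nat \<lfloor>y\<rfloor>. real n powr -\<alpha> / ln (real n)))"
    using assms \<alpha> by (intro sum_primes_powr_le) auto
  also have "(\<Sum>n=2..nat \<lfloor>y\<rfloor>. real n powr -\<alpha> / ln (real n))
      \<le> 20 / 19 * (u * ln u) / ((1 - \<alpha>) * ln y)
        + (u * ln u) powr (19 / 20) * (ln (ln y) + 2)"
    using sum_powr_div_ln_le[of \<alpha> y] assms \<alpha> by (simp add: ypow)
  \<comment> \<open>By the choice of \<open>\<alpha>\<close> the denominator
    \<open>(1 - \<alpha>) * ln y\<close> equals \<open>s \<ge> ln u\<close>, which cancels the
    factor \<open>ln u\<close>.\<close>
  also have "20 / 19 * (u * ln u) / ((1 - \<alpha>) * ln y) = 20 / 19 * u * (ln u / s)"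
    using lny by (simp add: \<alpha>_def)
  also have "\<dots> \<le> 20 / 19 * u * 1"
    using s lnu assms by (intro mult_left_mono) auto
  finally have "ln (real (smooth_count x y)) \<le> \<alpha> * ln x
      + ln 4 * (2 + (20 / 19 * u * 1 + (u * ln u) powr (19 / 20) * (ln (ln y) + 2)))
      + 4 * (\<Sum>n. real n powr - (2 * (1 - \<beta>)))"
    by simp
  \<comment> \<open>The whole saving \<open>u * s\<close> comes from the factor
    \<open>x powr \<alpha>\<close>.\<close>
  moreover have "\<alpha> * ln x = ln x - u * s"
    using lny by (simp add: \<alpha>_def lnx field_simps)
  ultimately show ?thesis
    by (simp add: s_def algebra_simps)
qed

section \<open>Uniform absorption of the error terms\<close>

text \<open>The lower limit on \<open>ln x\<close> gives
  \<open>u \<ge> ln y powr (\<nu> - 1)\<close>. Hence \<open>u\<close> tends to infinity uniformly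
  over the admissible pairs, and \<open>ln (ln y)\<close> is at most a constant times
  \<open>ln u\<close>, so the error is controlled by \<open>u\<close> alone.\<close>

lemma eventually_smooth_count_bound:
  fixes \<beta> \<nu> :: real
  assumes "0 < \<beta>" "\<beta> < 1 / 2" "\<nu> > 1"
  shows "\<exists>y0 \<ge> 16. \<forall>x y u. admissible \<beta> \<nu> x y \<and> y > y0 \<and> u = ln x / ln y \<longrightarrow>
    u \<ge> 3 \<and> ln (real (smooth_count x y)) / ln x < 1 - (ln u + ln (ln u) - 3 / 2) / ln y"
proof -
  define M where "M = (\<Sum>n. real n powr - (2 * (1 - \<beta>)))"
  define A where "A = 2 * ln 4 + 4 * M"
  define c where "c = 1 / (\<nu> - 1)"
  have "c > 0"
    using assms by (simp add: c_def)
  \<comment> \<open>The error per unit of \<open>u\<close>; it tends to 0 since the exponent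
    \<open>19 / 20\<close> is below 1 and the other factors are logarithmic.\<close>
  define E where
    "E = (\<lambda>u. (A + ln 4 * ((u * ln u) powr (19 / 20) * (c * ln u + 2))) / u)"
  have "(E \<longlongrightarrow> 0) at_top"
    unfolding E_def using \<open>c > 0\<close> by real_asymp
  then have "\<forall>\<^sub>F u in at_top. E u < 1 / 50"
    by (rule order_tendstoD) auto
  then obtain u0 where u0: "\<And>u. u \<ge> u0 \<Longrightarrow> E u < 1 / 50"
    by (auto simp: eventually_at_top_linorder)
  have "filterlim (\<lambda>y. ln y powr (\<nu> - 1)) at_top at_top"
    using assms by real_asymp
  then have "\<forall>\<^sub>F y in at_top. ln y powr (\<nu> - 1) \<ge> max u0 3"
    by (simp only: filterlim_at_top)
  then obtain y0 where y0: "\<And>y. y \<ge> y0 \<Longrightarrow> ln y powr (\<nu> - 1) \<ge> max u0 3"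
    by (auto simp: eventually_at_top_linorder)
  show ?thesis
  \<comment> \<open>The value 16 exceeds \<open>exp 2\<close>, which later yields
    \<open>ln y > 2\<close>.\<close>
  proof (intro exI[of _ "max 16 y0"] conjI allI impI; (elim conjE)?)
    fix x y u :: real
    assume adm: "admissible \<beta> \<nu> x y" and y: "y > max 16 y0" and u: "u = ln x / ln y"
    have "exp 1 \<le> (3 :: real)"
      by (rule exp_le)
    then have lny: "ln y \<ge> 1"
      using y by (auto simp: ln_ge_iff)
    have "ln y powr (\<nu> - 1) = ln y powr \<nu> / ln y"
      using lny by (simp add: powr_diff)
    also have "\<dots> \<le> u"
      unfolding u using adm lny y by (intro divide_right_mono) (auto simp: admissible_def)
    finally have pow_le: "ln y powr (\<nu> - 1) \<le> u" .
    then have u3: "u \<ge> u0" "u \<ge> 3"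
      using y0[of y] y by auto
    then show "u \<ge> 3"
      by simp
    have lnu: "ln u > 0"
      using u3 by simp
    have lnx: "ln x = u * ln y"
      using u lny by simp
    have "(\<nu> - 1) * ln (ln y) \<le> ln u"
      using ln_mono[OF pow_le] lny by (simp add: ln_powr)
    then have lnlny: "ln (ln y) \<le> c * ln u"
      using assms by (simp add: c_def field_simps)
    have "ln (real (smooth_count x y)) \<le> ln x - u * (ln u + ln (ln u)) + ln 4 * (20 / 19) * u
        + (ln 4 * (2 + (u * ln u) powr (19 / 20) * (ln (ln y) + 2)) + 4 * M)"
      unfolding M_def using assms adm y u u3
      by (intro ln_smooth_count_le_explicit) (auto simp: admissible_def)
    also have "ln 4 * (2 + (u * ln u) powr (19 / 20) * (ln (ln y) + 2)) + 4 * M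
        \<le> ln 4 * (2 + (u * ln u) powr (19 / 20) * (c * ln u + 2)) + 4 * M"
      using lnlny by (intro add_mono mult_left_mono) auto
    also have "\<dots> = A + ln 4 * ((u * ln u) powr (19 / 20) * (c * ln u + 2))"
      by (simp add: A_def algebra_simps)
    also have "\<dots> = u * E u"
      using u3 by (simp add: E_def)
    also have "\<dots> < u * (1 / 50)"
      using u0[of u] u3 by (intro mult_strict_left_mono) auto
    finally have "ln (real (smooth_count x y))
        < ln x - u * (ln u + ln (ln u)) + ln 4 * (20 / 19) * u + u * (1 / 50)"
      by simp
    also have "\<dots> = ln x - u * (ln u + ln (ln u) - (ln 4 * (20 / 19) + 1 / 50))"
      by (simp add: algebra_simps)
    also have "\<dots> \<le> ln x - u * (ln u + ln (ln u) - 3 / 2)"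
    \<comment> \<open>With \<open>ln 4 \<le> 7 / 5\<close> the left-hand constant is at most
      \<open>28 / 19 + 1 / 50\<close>, just below \<open>3 / 2\<close>.\<close>
    proof -
      have "ln (4 :: real) = 2 * ln 2"
        using ln_realpow[of 2 2] by simp
      then have "ln 4 * (20 / 19) + 1 / 50 \<le> (3 / 2 :: real)"
        using ln_2_le by simp
      then show ?thesis
        using u3 by (intro diff_left_mono mult_left_mono) auto
    qed
    finally have "ln (real (smooth_count x y)) / ln x
        < (ln x - u * (ln u + ln (ln u) - 3 / 2)) / ln x"
      using u3 lny lnx by (intro divide_strict_right_mono) auto
    also have "\<dots> = 1 - (ln u + ln (ln u) - 3 / 2) / ln y"
      using u3 lny by (simp add: lnx diff_divide_distrib)
    finally show "ln (real (smooth_count x y)) / ln x < 1 - (ln u + ln (ln u) - 3 / 2) / ln y" .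
  qed auto
qed

section \<open>Comparison with \<open>a_star\<close> and the iterated logarithms\<close>

text \<open>Equivalent to \<open>exp 1 - 1 > t\<close> for \<open>t = exp (1 / 2)\<close>. From
  \<open>t \<ge> 13 / 8\<close> one gets
  \<open>t\<^sup>2 - t \<ge> 5 / 8 * t \<ge> 65 / 64 > 1\<close>.\<close>

lemma a_star_gt: "a_star > 3 / 2"
proof -
  define t where "t = exp (1 / 2 :: real)"
  have t: "t\<^sup>2 = exp 1"
    by (simp add: t_def power2_eq_square flip: exp_add)
  have "1 + 1 / 2 + (1 / 2)\<^sup>2 / 2 \<le> t"
    unfolding t_def by (rule exp_lower_Taylor_quadratic) auto
  then have "13 / 8 \<le> t"
    by (simp add: power2_eq_square)
  then have "13 / 8 * t \<le> t\<^sup>2"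
    by (simp add: power2_eq_square)
  then have "t < exp 1 - 1"
    using \<open>13 / 8 \<le> t\<close> t by linarith
  then have "1 / 2 < ln (exp 1 - 1 :: real)"
    unfolding t_def by (metis exp_gt_zero less_trans ln_exp ln_less_cancel_iff)
  then show ?thesis
    by (simp add: a_star_def)
qed

text \<open>Three comparisons turn the bound in \<open>u\<close> into \<open>main_bound\<close>:
  \<open>ln (ln x) - ln (ln y)\<close> equals \<open>ln u\<close>, the triple logarithm of
  \<open>x\<close> exceeds \<open>ln (ln u)\<close> by at most \<open>- ln (1 - 1 / \<nu>)\<close>,
  and the fourfold logarithm of \<open>x\<close> is at most the triple logarithm of
  \<open>y\<close>. The condition on \<open>a\<close> pays for the second.\<close>

lemma bounds_hold_if:
  fixes \<beta> \<nu> a :: real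
  assumes "0 < \<beta>" "\<beta> < 1 / 2" "\<nu> > 1" "a \<ge> 3 / 2 - ln (1 - 1 / \<nu>)"
  shows "bounds_hold \<beta> \<nu> a"
proof -
  obtain y0 where y0: "y0 \<ge> 16" and bound: "\<And>x y u. admissible \<beta> \<nu> x y \<Longrightarrow> y > y0 \<Longrightarrow>
      u = ln x / ln y \<Longrightarrow> u \<ge> 3 \<and>
      ln (real (smooth_count x y)) / ln x < 1 - (ln u + ln (ln u) - 3 / 2) / ln y"
    using eventually_smooth_count_bound[OF assms(1-3)] by auto
  have main: "ln x / ln y \<ge> 3 \<and> ln (real (smooth_count x y)) / ln x < main_bound a x y"
    if adm: "admissible \<beta> \<nu> x y" and y: "y > y0" for x y
  proof -
    define u where "u = ln x / ln y"
    have u3: "u \<ge> 3"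
      and *: "ln (real (smooth_count x y)) / ln x < 1 - (ln u + ln (ln u) - 3 / 2) / ln y"
      using bound[OF adm y u_def] by auto
    have "ln y > 2"
    proof -
      have "exp 2 = (exp 1 :: real) * exp 1"
        by (simp flip: exp_add)
      also have "\<dots> \<le> 3 * 3"
        using exp_le by (intro mult_mono) auto
      finally show ?thesis
        using y y0 ln_less_cancel_iff[of "exp 2" y] by simp
    qed
    then have lny: "ln y > 2" "ln (ln y) > 0"
      by auto
    have lnx: "ln x = u * ln y"
      using lny by (simp add: u_def)
    have ln2x: "ln (ln x) = ln u + ln (ln y)"
      unfolding lnx using u3 lny by (subst ln_mult_pos) auto
    have lnu: "ln u > 0"
      using u3 by simp
    have "ln x > ln y powr \<nu>" "ln x < y powr \<beta>"
      using adm by (auto simp: admissible_def)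
    moreover have "y powr \<beta> \<le> y powr 1"
      using y y0 assms by (intro powr_mono) auto
    ultimately have lnx_le: "ln x \<le> y"
      using y y0 by simp
    have "\<nu> * ln (ln y) = ln (ln y powr \<nu>)"
      using lny by (simp add: ln_powr)
    also have "\<dots> \<le> ln (ln x)"
      using \<open>ln x > ln y powr \<nu>\<close> lny by (intro ln_mono) auto
    finally have "ln (ln y) \<le> ln (ln x) / \<nu>"
      using assms by (simp add: field_simps)
    \<comment> \<open>Since \<open>ln u = ln (ln x) - ln (ln y)\<close> and \<open>ln (ln y)\<close>
      is at most the fraction \<open>1 / \<nu>\<close> of \<open>ln (ln x)\<close>.\<close>
    then have "(1 - 1 / \<nu>) * ln (ln x) \<le> ln u"
      using ln2x by (simp add: left_diff_distrib)
    moreover have ln2x_pos: "ln (ln x) > 1"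
    proof -
      have "6 < ln x"
        using mult_le_less_imp_less[of 3 u 2 "ln y"] u3 lny lnx by simp
      then show ?thesis
        using exp_le ln_less_cancel_iff[of "exp 1" "ln x"] by simp
    qed
    moreover have "1 - 1 / \<nu> > 0"
      using assms by simp
    ultimately have "ln ((1 - 1 / \<nu>) * ln (ln x)) \<le> ln (ln u)"
      by (intro ln_mono) auto
    then have lnlnu: "ln (1 - 1 / \<nu>) + ln (ln (ln x)) \<le> ln (ln u)"
      using ln2x_pos \<open>1 - 1 / \<nu> > 0\<close> by (subst (asm) ln_mult_pos) auto
    have "ln (ln x) \<le> ln y"
      using lnx_le u3 lny lnx by (intro ln_mono) auto
    then have ln3x: "ln (ln (ln x)) \<le> ln (ln y)"
      using ln2x_pos by (auto dest: ln_mono)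
    have ln4x: "ln (ln (ln (ln x))) \<le> ln (ln (ln y))"
      using ln_mono[OF ln3x] ln2x_pos by simp
    have "1 - (ln u + ln (ln u) - 3 / 2) / ln y
        \<le> 1 - (ln (ln x) + ln (ln (ln x)) + ln (ln (ln (ln x)))
              - (a + ln (ln y) + ln (ln (ln y)))) / ln y"
      using lnlnu ln4x ln2x assms lny by (intro diff_left_mono divide_right_mono) auto
    also have "\<dots> = main_bound a x y"
      by (simp add: main_bound_def iter_ln_def eval_nat_numeral diff_divide_distrib)
    finally show ?thesis
      using * u3 by (simp add: u_def)
  qed
  \<comment> \<open>The extra term \<open>ln u / u\<close> is nonnegative for
    \<open>u \<ge> 3\<close>, so the same threshold serves both bounds.\<close>
  have "(let u = ln x / ln y in
      ln (real (smooth_count x y)) / ln x < main_bound a x y + ln u / u)"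
    if "admissible \<beta> \<nu> x y" "y > y0" for x y
  proof -
    have "ln u / u \<ge> 0" if "u \<ge> 3" for u :: real
      using that by simp
    with main[OF that] have "ln (ln x / ln y) / (ln x / ln y) \<ge> 0"
      by blast
    then show ?thesis
      using main[OF that] by (simp add: Let_def)
  qed
  with main show ?thesis
    unfolding bounds_hold_def by blast
qed

theorem theorem7p2:
  shows "(\<forall>\<beta> \<nu> :: real. 0 < \<beta> \<and> \<beta> < 1/2 \<and> 1 < \<nu> \<longrightarrow>
            (\<exists>a > a_star. bounds_hold \<beta> \<nu> a)) \<and>
         (\<forall>\<epsilon> > 0. \<exists>\<beta>0 > 0. \<exists>\<nu>0. \<forall>\<beta> \<nu> :: real.
            0 < \<beta> \<and> \<beta> < 1/2 \<and> 0 < \<nu> \<and> \<beta> < \<beta>0 \<and> \<nu> > \<nu>0 \<longrightarrow>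
            (\<exists>a. a_star < a \<and> a < a_star + \<epsilon> \<and> bounds_hold \<beta> \<nu> a))"
proof (intro conjI allI impI)
  fix \<beta> \<nu> :: real
  assume *: "0 < \<beta> \<and> \<beta> < 1/2 \<and> 1 < \<nu>"
  \<comment> \<open>The summand \<open>- ln (1 - 1 / \<nu>) \<ge> 0\<close> meets the condition of
    \<open>bounds_hold_if\<close>, and the summand 1 makes \<open>a > a_star\<close> strict.\<close>
  define a where "a = a_star + 1 - ln (1 - 1 / \<nu>)"
  have "ln (1 - 1 / \<nu>) \<le> 0"
    using * by simp
  then have "a > a_star" "a \<ge> 3 / 2 - ln (1 - 1 / \<nu>)"
    using a_star_gt by (simp_all add: a_def)
  moreover have "bounds_hold \<beta> \<nu> a"
    using * calculation by (intro bounds_hold_if) auto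
  ultimately show "\<exists>a > a_star. bounds_hold \<beta> \<nu> a"
    by blast
next
  fix \<epsilon> :: real
  assume \<epsilon>: "\<epsilon> > 0"
  \<comment> \<open>Chosen so that \<open>- ln (1 - 1 / \<nu>0) = \<epsilon> / 2\<close>; for larger
    \<open>\<nu>\<close> the loss is smaller, and \<open>a_star + \<epsilon> / 2\<close> is large
    enough.\<close>
  define \<nu>0 where "\<nu>0 = 1 / (1 - exp (- \<epsilon> / 2))"
  have \<nu>0: "\<nu>0 > 1"
    using \<epsilon> by (simp add: \<nu>0_def)
  have "\<exists>a. a_star < a \<and> a < a_star + \<epsilon> \<and> bounds_hold \<beta> \<nu> a"
    if "0 < \<beta> \<and> \<beta> < 1/2 \<and> 0 < \<nu> \<and> \<beta> < 1 \<and> \<nu> > \<nu>0" for \<beta> \<nu> :: real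
  proof (intro exI[of _ "a_star + \<epsilon> / 2"] conjI)
    have "1 / \<nu> < 1 / \<nu>0"
      using that \<nu>0 by (intro divide_strict_left_mono) auto
    then have "exp (- \<epsilon> / 2) \<le> 1 - 1 / \<nu>"
      by (simp add: \<nu>0_def)
    then have "- \<epsilon> / 2 \<le> ln (1 - 1 / \<nu>)"
      using ln_mono[of "exp (- \<epsilon> / 2)"] by simp
    then show "bounds_hold \<beta> \<nu> (a_star + \<epsilon> / 2)"
      using that \<nu>0 a_star_gt by (intro bounds_hold_if) auto
  qed (use \<epsilon> in auto)
  then show "\<exists>\<beta>0 > 0. \<exists>\<nu>0. \<forall>\<beta> \<nu> :: real.
      0 < \<beta> \<and> \<beta> < 1/2 \<and> 0 < \<nu> \<and> \<beta> < \<beta>0 \<and> \<nu> > \<nu>0 \<longrightarrow>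
      (\<exists>a. a_star < a \<and> a < a_star + \<epsilon> \<and> bounds_hold \<beta> \<nu> a)"
    using zero_less_one by blast
qed

end
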